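(* Let $g\ge4$ be an even integer, let $p$ be a prime number with $p>g-1$, and let $n\ge1$ be an integer. If the multiplicative order $o_g(p)$ of $g$ modulo $p$ is even, then $p^n$ is complete. If $o_g(p)$ is odd and $g$ is a perfect square, then $p^n$ is complete.
   Context: Fix an even integer $g\ge4$. For an odd integer $m\ge1$, an extreme cycle for the digit set $\{0,m\}$ is a finite set of distinct integers $\{x_0,\dots,x_{r-1}\}$ together with digits $l_0,\dots,l_{r-1}\in\{0,m\}$ such that $x_{j+1}=(x_j+l_j)/g$ for $0\le j\le r-2$ and $x_0=(x_{r-1}+l_{r-1})/g$. The cycle $\{0\}$ (with digit $0$) is the trivial extreme cycle. The number $m$ is complete if the only extreme cycle for $\{0,m\}$ is the trivial one, and incomplete otherwise. For $m$ coprime to $g$, $o_g(m)$ denotes the order of $g$ in the multiplicative group $U(\mathbb{Z}_m)$. *)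

theory Defs
  imports Complex_Main "HOL-Number_Theory.Number_Theory"
    "HOL-Computational_Algebra.Nth_Powers"
begin

text \<open>
  A cycle is given by the list of its distinct integer points together with the list of
  digits used at these points. The division is that of the reals: each quotient has to be
  an integer. The parities of \<open>g\<close> and \<open>m\<close> are not part of the definitions; they are
  imposed where the notions are used.
\<close>

definition extreme_cycle :: "nat \<Rightarrow> nat \<Rightarrow> int list \<Rightarrow> int list \<Rightarrow> bool" where
  "extreme_cycle g m xs ls \<longleftrightarrow>
     xs \<noteq> [] \<and> length ls = length xs \<and> distinct xs \<and> set ls \<subseteq> {0, int m} \<and>
     (\<forall>j. j + 1 < length xs \<longrightarrow>
        real_of_int (xs ! (j + 1)) = (real_of_int (xs ! j) + real_of_int (ls ! j)) / real g) \<and>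
     real_of_int (xs ! 0) =
       (real_of_int (xs ! (length xs - 1)) + real_of_int (ls ! (length xs - 1))) / real g"

definition complete_number :: "nat \<Rightarrow> nat \<Rightarrow> bool" where
  "complete_number g m \<longleftrightarrow> (\<forall>xs ls. extreme_cycle g m xs ls \<longleftrightarrow> xs = [0] \<and> ls = [0])"

end

theory Submission
  imports Defs
begin

text \<open>
  The points of an extreme cycle for \<open>{0, m}\<close> lie in the interval from \<open>0\<close> to \<open>m / (g - 1)\<close>, and
  modulo \<open>m\<close> the cycle is closed under multiplication by \<open>g\<close>. Modulo an odd prime power the only
  square roots of \<open>1\<close> are \<open>1\<close> and \<open>-1\<close>. If \<open>g\<close> has even order, some power of \<open>g\<close> is therefore
  \<open>-1\<close>, and with \<open>x\<close> the cycle contains \<open>m - x\<close>, which is too large. If \<open>g = s\<^sup>2\<close> has odd order,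
  then \<open>s\<close> or \<open>-s\<close> is a power of \<open>g\<close>: in the first case the largest point \<open>x\<close> would be followed
  by the larger point \<open>s x\<close>, in the second the cycle contains \<open>m - s x\<close>, which is too large.
\<close>

section \<open>Steps of a cycle, bounds on its points, closure under multiplication by
  \<open>g\<close>\<close>

lemma extreme_cycle_step:
  assumes "extreme_cycle g m xs ls" "g > 0" "j < length xs"
  shows "int g * xs ! (Suc j mod length xs) = xs ! j + ls ! j"
proof -
  have "real_of_int (xs ! (Suc j mod length xs)) =
    (real_of_int (xs ! j) + real_of_int (ls ! j)) / real g"
  proof (cases "Suc j < length xs")
    case True
    then show ?thesis using assms(1) by (simp add: extreme_cycle_def)
  next
    case False
    with assms(3) have "Suc j = length xs" "j = length xs - 1" by simp_all
    then show ?thesis using assms(1) by (simp add: extreme_cycle_def)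
  qed
  then have "real_of_int (int g * xs ! (Suc j mod length xs)) = real_of_int (xs ! j + ls ! j)"
    using assms(2) by (simp add: field_simps)
  then show ?thesis by (simp only: of_int_eq_iff)
qed

lemma extreme_cycle_digit:
  assumes "extreme_cycle g m xs ls" "j < length xs"
  shows "ls ! j = 0 \<or> ls ! j = int m"
proof -
  have "ls ! j \<in> set ls" "set ls \<subseteq> {0, int m}"
    using assms by (auto simp: extreme_cycle_def)
  then show ?thesis by blast
qed

lemma extreme_cycle_pred:
  assumes "extreme_cycle g m xs ls" "g > 0" "x \<in> set xs"
  obtains y l where "y \<in> set xs" "l = 0 \<or> l = int m" "int g * x = y + l"
proof -
  obtain i where i: "i < length xs" "x = xs ! i"
    using assms(3) by (auto simp: in_set_conv_nth)
  define j where "j = (if i = 0 then length xs - 1 else i - 1)"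
  have j: "j < length xs" "Suc j mod length xs = i"
    using i by (auto simp: j_def)
  show thesis
    using that[of "xs ! j" "ls ! j"] extreme_cycle_step[OF assms(1,2) j(1)]
      extreme_cycle_digit[OF assms(1) j(1)] j i by auto
qed

text \<open>The least point \<open>a\<close> has a predecessor \<open>y\<close> that is at least
  \<open>a\<close>, and digits are nonnegative, so \<open>g * a = y + l\<close> is at least
  \<open>a\<close>. The upper bound below is dual, with the largest point and \<open>l\<close> at
  most \<open>m\<close>.\<close>

lemma extreme_cycle_nonneg:
  assumes "extreme_cycle g m xs ls" "g \<ge> 2" "x \<in> set xs"
  shows "0 \<le> x"
proof -
  define a where "a = Min (set xs)"
  have a: "a \<in> set xs" "a \<le> x"
    using assms(3) Min_in[of "set xs"] by (auto simp: a_def intro!: Min_in)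
  have "g > 0" using assms(2) by simp
  then obtain y l where y: "y \<in> set xs" "l = 0 \<or> l = int m" "int g * a = y + l"
    using extreme_cycle_pred[OF assms(1) _ a(1)] by metis
  have "a \<le> y" using y(1) by (simp add: a_def)
  with y have "0 \<le> (int g - 1) * a" by (auto simp: algebra_simps)
  with assms(2) have "0 \<le> a" by (simp add: zero_le_mult_iff)
  with a(2) show ?thesis by simp
qed

lemma extreme_cycle_upper:
  assumes "extreme_cycle g m xs ls" "g \<ge> 2" "x \<in> set xs"
  shows "(int g - 1) * x \<le> int m"
proof -
  define b where "b = Max (set xs)"
  have b: "b \<in> set xs" "x \<le> b"
    using assms(3) Max_in[of "set xs"] by (auto simp: b_def intro!: Max_in)
  have "g > 0" using assms(2) by simp
  then obtain y l where y: "y \<in> set xs" "l = 0 \<or> l = int m" "int g * b = y + l"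
    using extreme_cycle_pred[OF assms(1) _ b(1)] by metis
  have "y \<le> b" using y(1) by (simp add: b_def)
  with y have "(int g - 1) * b \<le> int m" by (auto simp: algebra_simps)
  moreover have "(int g - 1) * x \<le> (int g - 1) * b"
    using assms(2) b(2) by (intro mult_left_mono) auto
  ultimately show ?thesis by simp
qed

text \<open>Digits vanish modulo \<open>m\<close>, so \<open>g * x = y + l\<close> makes the
  predecessor \<open>y\<close> congruent to \<open>g * x\<close>: multiplication by \<open>g\<close>
  runs through the cycle backwards.\<close>

lemma extreme_cycle_power_closed:
  assumes "extreme_cycle g m xs ls" "g > 0" "x \<in> set xs"
  shows "\<exists>y\<in>set xs. [y = int g ^ k * x] (mod int m)"
proof (induction k)
  case 0
  then show ?case using assms(3) by (auto intro!: bexI[of _ x])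
next
  case (Suc k)
  then obtain y where y: "y \<in> set xs" "[y = int g ^ k * x] (mod int m)" by blast
  obtain z l where z: "z \<in> set xs" "l = 0 \<or> l = int m" "int g * y = z + l"
    using extreme_cycle_pred[OF assms(1,2) y(1)] .
  have "[z = int g * y] (mod int m)"
    using z(2,3) by (auto simp: cong_def)
  also have "[int g * y = int g * (int g ^ k * x)] (mod int m)"
    using y(2) by (rule cong_scalar_left)
  finally show ?case using z(1) by (auto simp: mult.assoc)
qed

text \<open>The successor of 0 is its digit divided by \<open>g\<close>. The digit \<open>m\<close>
  would force \<open>g dvd m\<close>, so 0 follows itself, and distinctness leaves room for one
  point only.\<close>

lemma extreme_cycle_zero:
  assumes "extreme_cycle g m xs ls" "g > 0" "\<not> g dvd m" "0 \<in> set xs"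
  shows "xs = [0] \<and> ls = [0]"
proof -
  obtain j where j: "j < length xs" "xs ! j = 0"
    using assms(4) by (auto simp: in_set_conv_nth)
  define k where "k = Suc j mod length xs"
  have k: "k < length xs" using j(1) unfolding k_def by (intro mod_less_divisor) auto
  have step: "int g * xs ! k = ls ! j"
    using extreme_cycle_step[OF assms(1,2) j(1)] j(2) by (simp add: k_def)
  have "ls ! j \<noteq> int m"
  proof
    assume "ls ! j = int m"
    with step have "int g dvd int m" by (metis dvd_triv_left)
    with assms(3) show False by simp
  qed
  with extreme_cycle_digit[OF assms(1) j(1)] have l: "ls ! j = 0" by blast
  with step assms(2) have "xs ! k = xs ! j" using j(2) by simp
  then have "k = j"
    using assms(1) j(1) k by (simp add: extreme_cycle_def nth_eq_iff_index_eq)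
  then have len: "length xs = 1"
    using j(1) unfolding k_def by (cases "Suc j = length xs") auto
  then have "j = 0" "length ls = 1"
    using j(1) assms(1) by (auto simp: extreme_cycle_def)
  with len j l show ?thesis
    by (auto simp: length_Suc_conv)
qed

lemma complete_numberI:
  assumes "g \<ge> 2" "\<not> g dvd m"
    and "\<And>xs ls. extreme_cycle g m xs ls \<Longrightarrow> 0 \<notin> set xs \<Longrightarrow> False"
  shows "complete_number g m"
proof -
  have "extreme_cycle g m [0] [0]" by (simp add: extreme_cycle_def)
  moreover have "xs = [0] \<and> ls = [0]" if "extreme_cycle g m xs ls" for xs ls
    using extreme_cycle_zero[OF that] assms that by fastforce
  ultimately show ?thesis unfolding complete_number_def by blast
qed

text \<open>An odd prime cannot divide both \<open>h - 1\<close> and \<open>h + 1\<close>, which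
  differ by 2. So \<open>p ^ n\<close> is coprime to one of them and divides the other.\<close>

lemma square_cong_1_mod_odd_prime_power:
  fixes h :: int and p :: nat
  assumes "prime p" "odd p" "[h\<^sup>2 = 1] (mod int (p ^ n))"
  shows "[h = 1] (mod int (p ^ n)) \<or> [h = -1] (mod int (p ^ n))"
proof -
  have d: "int p ^ n dvd (h - 1) * (h + 1)"
    using assms(3) by (simp add: cong_iff_dvd_diff power2_eq_square algebra_simps)
  have pr: "prime (int p)" using assms(1) by simp
  have "\<not> (int p dvd h - 1 \<and> int p dvd h + 1)"
  proof
    assume "int p dvd h - 1 \<and> int p dvd h + 1"
    then have "int p dvd (h + 1) - (h - 1)" by (blast intro: dvd_diff)
    then have "int p dvd int 2" by simp
    then have "p dvd 2" by (simp only: int_dvd_int_iff)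
    with assms(1,2) show False
      by (metis dvd_refl primes_dvd_imp_eq two_is_prime_nat)
  qed
  then have "coprime (int p ^ n) (h - 1) \<or> coprime (int p ^ n) (h + 1)"
    using pr by (auto intro: prime_imp_coprime)
  with d have "int p ^ n dvd h + 1 \<or> int p ^ n dvd h - 1"
    by (auto simp: coprime_dvd_mult_right_iff coprime_dvd_mult_left_iff)
  then show ?thesis by (auto simp: cong_iff_dvd_diff)
qed

section \<open>Completeness when a power of \<open>g\<close> is -1 or a square root of
  \<open>g\<close> up to sign\<close>

lemma complete_number_if_power_cong_minus_1:
  fixes g m k :: nat
  assumes "g \<ge> 4" "\<not> g dvd m" "[int g ^ k = -1] (mod int m)"
  shows "complete_number g m"
proof (rule complete_numberI)
  fix xs ls assume cyc: "extreme_cycle g m xs ls" and "0 \<notin> set xs"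
  \<comment> \<open>As \<open>g - 1\<close> is at least 3, all points lie between 1 and
    \<open>m / 3\<close>, which rules out having both \<open>x\<close> and
    \<open>m - x\<close>.\<close>
  have up: "3 * x \<le> int m" "0 < x" if "x \<in> set xs" for x
  proof -
    show "0 < x"
      using extreme_cycle_nonneg[OF cyc _ that] assms(1) \<open>0 \<notin> set xs\<close> that
      by (cases "x = 0") auto
    then have "3 * x \<le> (int g - 1) * x"
      using assms(1) by (intro mult_right_mono) auto
    then show "3 * x \<le> int m"
      using extreme_cycle_upper[OF cyc _ that] assms(1) by simp
  qed
  obtain x where x: "x \<in> set xs"
    using cyc by (cases xs) (auto simp: extreme_cycle_def)
  obtain y where y: "y \<in> set xs" "[y = int g ^ k * x] (mod int m)"
    using extreme_cycle_power_closed[OF cyc _ x] assms(1) by fastforce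
  have "[int g ^ k * x = -1 * x] (mod int m)"
    using assms(3) by (rule cong_scalar_right)
  with y(2) have "[y = -1 * x] (mod int m)" by (rule cong_trans)
  then have "[y = int m - x] (mod int m)" by (simp add: cong_def)
  then have "y = int m - x"
    using up[OF x] up[OF y(1)] by (intro cong_less_imp_eq_int) auto
  with up[OF x] up[OF y(1)] show False by simp
qed (use assms in auto)

lemma complete_number_if_power_cong_sqrt:
  fixes s m k :: nat
  assumes "s \<ge> 2" "\<not> s\<^sup>2 dvd m" "\<not> s\<^sup>2 - 1 dvd m"
    and "[int (s\<^sup>2) ^ k = int s] (mod int m) \<or> [int (s\<^sup>2) ^ k = - int s] (mod int m)"
  shows "complete_number (s\<^sup>2) m"
proof (rule complete_numberI)
  have "2\<^sup>2 \<le> s\<^sup>2" using assms(1) by (rule power_mono) simp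
  then show g: "2 \<le> s\<^sup>2" by simp
  show "\<not> s\<^sup>2 dvd m" by fact
  fix xs ls assume cyc: "extreme_cycle (s\<^sup>2) m xs ls" and "0 \<notin> set xs"
  have pos: "0 < x" if "x \<in> set xs" for x
    using extreme_cycle_nonneg[OF cyc g that] \<open>0 \<notin> set xs\<close> that by (cases "x = 0") auto
  \<comment> \<open>Equality in the upper bound would make \<open>g - 1\<close> a divisor of
    \<open>m\<close>.\<close>
  have strict: "((int s)\<^sup>2 - 1) * x < int m" if "x \<in> set xs" for x
  proof -
    have "((int s)\<^sup>2 - 1) * x \<noteq> int m"
    proof
      assume "((int s)\<^sup>2 - 1) * x = int m"
      then have "int (s\<^sup>2 - 1) dvd int m"
        using g by (metis dvd_triv_left of_nat_1 of_nat_diff of_nat_power one_le_numeral order_trans)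
      with assms(3) show False by (simp only: int_dvd_int_iff)
    qed
    with extreme_cycle_upper[OF cyc g that] show ?thesis by simp
  qed
  \<comment> \<open>The factorization of \<open>g - 1\<close> as \<open>(s + 1) * (s - 1)\<close>.
    For \<open>s = 2\<close> this is an equality, so strictness in \<open>small\<close> has to come
    from \<open>strict\<close>.\<close>
  have mono: "(int s + 1) * x \<le> ((int s)\<^sup>2 - 1) * x" if "x \<in> set xs" for x
  proof -
    have "(int s + 1) * 1 \<le> (int s + 1) * (int s - 1)"
      using assms(1) by (intro mult_left_mono) auto
    then have "int s + 1 \<le> (int s)\<^sup>2 - 1" by (simp add: power2_eq_square algebra_simps)
    then show ?thesis using pos[OF that] by (intro mult_right_mono) auto
  qed
  have small: "int s * x + x < int m" if "x \<in> set xs" for x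
    using strict[OF that] mono[OF that] by (simp add: algebra_simps)
  have spos: "0 < int s * x" if "x \<in> set xs" for x
    using pos[OF that] assms(1) by simp
  \<comment> \<open>Both signs contradict the maximality of \<open>x\<close>: \<open>s * x\<close>
    exceeds \<open>x\<close> as \<open>s\<close> is at least 2, and \<open>m - s * x\<close> exceeds
    \<open>x\<close> by \<open>small\<close>. The bounds put all these numbers strictly between 0
    and \<open>m\<close>, so congruence becomes equality.\<close>
  define x where "x = Max (set xs)"
  have x: "x \<in> set xs"
    using cyc unfolding x_def by (intro Max_in) (auto simp: extreme_cycle_def)
  have "s\<^sup>2 > 0" using assms(1) by simp
  then obtain y where y: "y \<in> set xs" "[y = int (s\<^sup>2) ^ k * x] (mod int m)"
    using extreme_cycle_power_closed[OF cyc _ x] by blast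
  have "y \<le> x" using y(1) by (simp add: x_def)
  from assms(4) show False
  proof
    assume "[int (s\<^sup>2) ^ k = int s] (mod int m)"
    then have "[int (s\<^sup>2) ^ k * x = int s * x] (mod int m)" by (rule cong_scalar_right)
    with y(2) have "[y = int s * x] (mod int m)" by (rule cong_trans)
    then have "y = int s * x"
      using pos[OF x] pos[OF y(1)] spos[OF x] spos[OF y(1)] small[OF x] small[OF y(1)]
      by (intro cong_less_imp_eq_int) auto
    moreover have "1 * x < int s * x"
      using assms(1) pos[OF x] by (intro mult_strict_right_mono) auto
    ultimately show False using \<open>y \<le> x\<close> by simp
  next
    assume "[int (s\<^sup>2) ^ k = - int s] (mod int m)"
    then have "[int (s\<^sup>2) ^ k * x = - int s * x] (mod int m)" by (rule cong_scalar_right)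
    with y(2) have "[y = - int s * x] (mod int m)" by (rule cong_trans)
    then have "[y = int m - int s * x] (mod int m)" by (simp add: cong_def)
    then have "y = int m - int s * x"
      using pos[OF x] pos[OF y(1)] spos[OF x] spos[OF y(1)] small[OF x] small[OF y(1)]
      by (intro cong_less_imp_eq_int) auto
    with \<open>y \<le> x\<close> small[OF x] show False by simp
  qed
qed

text \<open>Raising \<open>g\<close> to half its order gives a square root of 1 that is not 1
  itself, the exponent being smaller than the order.\<close>

lemma even_ord_imp_power_cong_minus_1:
  fixes g p n :: nat
  assumes "prime p" "odd p" "coprime p g" "even (ord (p ^ n) g)"
  shows "[int g ^ (ord (p ^ n) g div 2) = -1] (mod int (p ^ n))"
proof -
  define k where "k = ord (p ^ n) g div 2"
  have o: "ord (p ^ n) g = k * 2" using assms(4) by (simp add: k_def)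
  have cop: "coprime (p ^ n) g" using assms(3) by simp
  \<comment> \<open>The default value 0 of \<open>ord\<close> is even too; positivity makes the half
    a proper exponent.\<close>
  then have "ord (p ^ n) g > 0" by (simp add: ord_eq_0)
  then have k: "0 < k" "k < ord (p ^ n) g" using o by simp_all
  have "[g ^ (k * 2) = 1] (mod p ^ n)" using ord[of g "p ^ n"] o by simp
  then have "[int (g ^ (k * 2)) = int 1] (mod int (p ^ n))" by (simp only: cong_int_iff)
  then have "[(int g ^ k)\<^sup>2 = 1] (mod int (p ^ n))" by (simp add: power_mult)
  then have "[int g ^ k = 1] (mod int (p ^ n)) \<or> [int g ^ k = -1] (mod int (p ^ n))"
    by (rule square_cong_1_mod_odd_prime_power[OF assms(1,2)])
  moreover have "\<not> [int g ^ k = 1] (mod int (p ^ n))"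
  proof
    assume "[int g ^ k = 1] (mod int (p ^ n))"
    then have "[int (g ^ k) = int 1] (mod int (p ^ n))" by simp
    then have "[g ^ k = 1] (mod p ^ n)" by (simp only: cong_int_iff)
    then have "ord (p ^ n) g dvd k" by (simp only: ord_divides)
    with k show False by (auto dest: dvd_imp_le)
  qed
  ultimately show ?thesis by (simp add: k_def)
qed

text \<open>If the order \<open>q\<close> is \<open>2 * j + 1\<close>, then \<open>s ^ q\<close> is
  a square root of 1, hence 1 or -1. Multiplying by \<open>s\<close> makes the exponent even:
  \<open>s ^ (q + 1)\<close> is the power of \<open>s * s\<close> with exponent
  \<open>j + 1\<close>.\<close>

lemma odd_ord_square_imp_power_cong_sqrt:
  fixes s p n :: nat
  assumes "prime p" "odd p" "odd (ord (p ^ n) (s\<^sup>2))"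
  obtains k where "[int (s\<^sup>2) ^ k = int s] (mod int (p ^ n)) \<or>
    [int (s\<^sup>2) ^ k = - int s] (mod int (p ^ n))"
proof -
  define q where "q = ord (p ^ n) (s\<^sup>2)"
  obtain j where j: "q = 2 * j + 1" using assms(3) by (auto simp: q_def elim: oddE)
  have "[(s\<^sup>2) ^ q = 1] (mod p ^ n)" unfolding q_def by (rule ord)
  then have "[int ((s\<^sup>2) ^ q) = int 1] (mod int (p ^ n))" by (simp only: cong_int_iff)
  then have "[(int s ^ q)\<^sup>2 = 1] (mod int (p ^ n))"
    by (simp add: power_mult[symmetric] mult.commute)
  then have "[int s ^ q = 1] (mod int (p ^ n)) \<or> [int s ^ q = -1] (mod int (p ^ n))"
    by (rule square_cong_1_mod_odd_prime_power[OF assms(1,2)])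
  then have "[int s ^ q * int s = 1 * int s] (mod int (p ^ n)) \<or>
      [int s ^ q * int s = -1 * int s] (mod int (p ^ n))"
    by (blast intro: cong_scalar_right)
  moreover have "int s ^ q * int s = int (s\<^sup>2) ^ (j + 1)"
    by (simp add: j power_mult power2_eq_square power_mult_distrib mult_ac)
  ultimately show thesis using that[of "j + 1"] by simp
qed

theorem theorem2p18:
  fixes g p n :: nat
  assumes "g \<ge> 4" and "even g" and "prime p" and "p > g - 1" and "n \<ge> 1"
  shows "(even (ord p g) \<longrightarrow> complete_number g (p ^ n)) \<and>
         (odd (ord p g) \<and> is_square g \<longrightarrow> complete_number g (p ^ n))"
proof -
  have "odd p" using assms prime_odd_nat[of p] by auto
  \<comment> \<open>With \<open>p > g - 1\<close> this gives \<open>g < p\<close>, so neither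
    \<open>g\<close> nor \<open>g - 1\<close> divides a power of \<open>p\<close>.\<close>
  have "p \<noteq> g" using \<open>odd p\<close> assms(2) by auto
  have no_dvd: "coprime p d" "\<not> d dvd p ^ n" if "1 < d" "d < p" for d
  proof -
    show "coprime p d"
      using that assms(3) by (auto intro!: prime_imp_coprime dest: dvd_imp_le)
    then have "coprime (p ^ n) d" by simp
    show "\<not> d dvd p ^ n"
    proof
      assume "d dvd p ^ n"
      with \<open>coprime (p ^ n) d\<close> have "is_unit d" by (metis coprime_common_divisor dvd_refl)
      with that show False by simp
    qed
  qed
  have g: "coprime p g" "\<not> g dvd p ^ n" "\<not> g - 1 dvd p ^ n"
    using no_dvd[of g] no_dvd[of "g - 1"] assms(1,4) \<open>p \<noteq> g\<close> by auto
  have ev: "complete_number g (p ^ n)" if "even (ord (p ^ n) g)"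
    using complete_number_if_power_cong_minus_1[OF assms(1) g(2)]
      even_ord_imp_power_cong_minus_1[OF assms(3) \<open>odd p\<close> g(1) that] .
  have "complete_number g (p ^ n)" if "even (ord p g)"
  proof (rule ev)
    \<comment> \<open>Reduction modulo \<open>p\<close> shows that the order modulo \<open>p\<close>
      divides the order modulo \<open>p ^ n\<close>, so evenness passes up.\<close>
    have "[g ^ ord (p ^ n) g = 1] (mod p ^ n)" by (rule ord)
    then have "[g ^ ord (p ^ n) g = 1] (mod p)"
      by (rule cong_dvd_modulus_nat) (use assms(5) in simp)
    then have "ord p g dvd ord (p ^ n) g" by (simp only: ord_divides)
    with that show "even (ord (p ^ n) g)" by (rule dvd_trans)
  qed
  moreover have "complete_number g (p ^ n)" if "is_square g"
  \<comment> \<open>The parity is that of the order modulo \<open>p ^ n\<close>, the modulus in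
    which the powers of \<open>g\<close> are compared with -1 and with \<open>s\<close>.\<close>
  proof (cases "even (ord (p ^ n) g)")
    case True
    then show ?thesis by (rule ev)
  next
    case False
    obtain s where s: "g = s\<^sup>2" using \<open>is_square g\<close> by (auto elim: is_nth_powerE)
    have "s \<ge> 2"
    proof (rule ccontr)
      assume "\<not> s \<ge> 2"
      then have "s\<^sup>2 \<le> 1\<^sup>2" by (intro power_mono) auto
      with s assms(1) show False by simp
    qed
    obtain k where "[int (s\<^sup>2) ^ k = int s] (mod int (p ^ n)) \<or>
        [int (s\<^sup>2) ^ k = - int s] (mod int (p ^ n))"
      using odd_ord_square_imp_power_cong_sqrt[OF assms(3) \<open>odd p\<close>] False s by metis
    then show ?thesis
      using complete_number_if_power_cong_sqrt[OF \<open>s \<ge> 2\<close>] g s by metis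
  qed
  ultimately show ?thesis by blast
qed

end
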